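(* Let $Q\subset E$ be convex, $f:Q\to\mathbb{R}$ convex with a minimizer $x_*\in Q$, $\delta,\widetilde\delta\ge0$, $0<\mu\le L$. Suppose that for every $y\in Q$, $\psi_\delta(\cdot,y)$ is a $(\delta,L)$-model of $f$ at $y$ with respect to $V[y](x)$, and that $f$ is right relatively $\mu$-strongly convex, i.e. for all $x,y\in Q$ $$\mu V[y](x)\le f(x)-f(y)-\psi_\delta(x,y).$$ Let $x_0\in Q$ and let $x_{k+1}=\arg\min^{\widetilde\delta}_{x\in Q}\{\psi_\delta(x,x_k)+L\,V[x_k](x)\}$ for $k\ge0$ (non-adaptive gradient method with constant step $1/L$). Let $y_{k+1}$ be a point among $x_1,\dots,x_{k+1}$ with the smallest value of $f$. Then for all $k\ge0$ $$f(y_{k+1})-f(x_* )\le L\,V[x_0](x_* )\exp\left(-(k+1)\frac\mu L\right)+\delta+\widetilde\delta$$ and $$V[x_{k+1}](x_* )\le\frac1\mu(\delta+\widetilde\delta)+\left(1-\frac\mu L\right)^{k+1}V[x_0](x_* ).$$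
   Context: $E$ is a finite-dimensional real vector space. $d$ is a convex differentiable function on $Q$ and $V[y](x)=d(x)-d(y)-\langle\nabla d(y),x-y\rangle$ (strong convexity of $d$ is not assumed). Model. $\psi_\delta(x,y)$ is a $(\delta,L)$-model of $f$ at $y\in Q$ w.r.t. $V[y](x)$ if there is $f_\delta(y)\in[f(y)-\delta,f(y)]$ such that for all $x\in Q$ $$0\le f(x)-\bigl(f_\delta(y)+\psi_\delta(x,y)\bigr)\le L\,V[y](x)+\delta,$$ $\psi_\delta(x,y)$ is convex in $x\in Q$, and $\psi_\delta(x,x)=0$ for all $x\in Q$. Inexact minimizer. For convex $\Psi$ on $Q$ and $\widetilde\delta\ge0$, $\arg\min^{\widetilde\delta}_{x\in Q}\Psi(x)$ denotes some point $\widetilde x\in Q$ for which there exists $h\in\partial\Psi(\widetilde x)$ with $\langle h,x-\widetilde x\rangle\ge-\widetilde\delta$ for all $x\in Q$. *)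

theory Defs
  imports "HOL-Analysis.Analysis"
begin

text \<open>The dual space of \<open>'a\<close> is the type \<open>'a \<Rightarrow>\<^sub>L real\<close>; in finite
  dimension every linear functional is bounded, and differentiability does not depend on the norm.\<close>

text \<open>\<open>bregman d grad_d y x\<close> is \<open>V[y](x)\<close>. The gradient is passed explicitly because it is
  determined only on the directions \<open>x - y\<close> with \<open>x \<in> Q\<close> when \<open>Q\<close> has empty interior.\<close>

definition bregman ::
  "('a::euclidean_space \<Rightarrow> real) \<Rightarrow> ('a \<Rightarrow> ('a \<Rightarrow>\<^sub>L real)) \<Rightarrow> 'a \<Rightarrow> 'a \<Rightarrow> real" where
  "bregman d grad_d y x = d x - d y - blinfun_apply (grad_d y) (x - y)"

text \<open>The functions \<open>f\<close> and \<open>\<psi>\<close> are total in HOL, but only their values on \<open>Q\<close> are used;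
  \<open>\<psi> x y\<close> is \<open>\<psi>\<^sub>\<delta>(x,y)\<close> and \<open>V y x\<close> is \<open>V[y](x)\<close>.\<close>

definition is_model ::
  "'a::euclidean_space set \<Rightarrow> ('a \<Rightarrow> 'a \<Rightarrow> real) \<Rightarrow> real \<Rightarrow> real \<Rightarrow> ('a \<Rightarrow> real) \<Rightarrow> ('a \<Rightarrow> 'a \<Rightarrow> real)
    \<Rightarrow> 'a \<Rightarrow> bool" where
  "is_model Q V \<delta> L f \<psi> y \<longleftrightarrow>
     (\<exists>f\<^sub>\<delta>\<in>{f y - \<delta>..f y}. \<forall>x\<in>Q.
        0 \<le> f x - (f\<^sub>\<delta> + \<psi> x y) \<and> f x - (f\<^sub>\<delta> + \<psi> x y) \<le> L * V y x + \<delta>) \<and>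
     convex_on Q (\<lambda>x. \<psi> x y) \<and>
     (\<forall>x\<in>Q. \<psi> x x = 0)"

definition right_relatively_strongly_convex ::
  "'a::euclidean_space set \<Rightarrow> ('a \<Rightarrow> 'a \<Rightarrow> real) \<Rightarrow> real \<Rightarrow> ('a \<Rightarrow> real) \<Rightarrow> ('a \<Rightarrow> 'a \<Rightarrow> real) \<Rightarrow> bool" where
  "right_relatively_strongly_convex Q V \<mu> f \<psi> \<longleftrightarrow>
     (\<forall>x\<in>Q. \<forall>y\<in>Q. \<mu> * V y x \<le> f x - f y - \<psi> x y)"

text \<open>\<open>\<Psi>\<close> is regarded as a function on \<open>Q\<close> only, so the subgradient inequality is required on \<open>Q\<close>.\<close>

definition subdifferential_on ::
  "'a::euclidean_space set \<Rightarrow> ('a \<Rightarrow> real) \<Rightarrow> 'a \<Rightarrow> ('a \<Rightarrow>\<^sub>L real) set" where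
  "subdifferential_on Q \<Psi> u = {h. \<forall>x\<in>Q. \<Psi> x \<ge> \<Psi> u + blinfun_apply h (x - u)}"

text \<open>The set of all admissible values of the inexact minimizer.\<close>

definition inexact_argmin ::
  "'a::euclidean_space set \<Rightarrow> real \<Rightarrow> ('a \<Rightarrow> real) \<Rightarrow> 'a set" where
  "inexact_argmin Q \<epsilon> \<Psi> =
     {u \<in> Q. \<exists>h\<in>subdifferential_on Q \<Psi> u. \<forall>x\<in>Q. blinfun_apply h (x - u) \<ge> - \<epsilon>}"

end

theory Submission
  imports Defs
begin

text \<open>With \<open>D = \<delta> + \<delta>'\<close>, convexity of the model turns approximate minimality of the
  subproblem into a first-order condition at \<open>u = x\<^bsub>k+1\<^esub>\<close>. Combined with the three-point identity
  for \<open>V\<close>, the upper model bound and right relative strong convexity, it gives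
  \<open>f u - f w \<le> (L - \<mu>) V[x\<^sub>k](w) - L V[u](w) + D\<close> for all \<open>w \<in> Q\<close>. At \<open>w = x\<^sub>*\<close> this is a linear
  recursion for \<open>V[x\<^sub>k](x\<^sub>*)\<close> with ratio \<open>q = 1 - \<mu>/L\<close>. Dropping the left side gives the bound
  on \<open>V\<close>; replacing it by the smallest gap and using \<open>V \<ge> 0\<close> and \<open>q \<le> exp (- \<mu>/L)\<close> gives the
  bound on \<open>f\<close>.\<close>

text \<open>Along the segment from \<open>u\<close> to \<open>x\<close>, which stays in
  \<open>Q\<close>, the one-sided difference quotients at \<open>0\<close> are at least
  \<open>c\<close> and tend to \<open>g' (x - u)\<close>. A derivative within \<open>Q\<close>
  suffices, so \<open>Q\<close> may have empty interior.\<close>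

lemma directional_derivative_ge:
  fixes g :: "'a::real_normed_vector \<Rightarrow> real"
  assumes Q: "convex Q" "u \<in> Q" "x \<in> Q"
    and g: "(g has_derivative g') (at u within Q)"
    and le: "\<And>t. 0 < t \<Longrightarrow> t \<le> 1 \<Longrightarrow> t * c \<le> g (u + t *\<^sub>R (x - u)) - g u"
  shows "c \<le> g' (x - u)"
proof -
  have sub: "(\<lambda>t. u + t *\<^sub>R (x - u)) ` {0..1} \<subseteq> Q"
  proof safe
    fix t :: real assume "t \<in> {0..1}"
    then show "u + t *\<^sub>R (x - u) \<in> Q"
      using convexD_alt[OF Q, of t] by (simp add: algebra_simps)
  qed
  interpret g': bounded_linear g' using g by (rule has_derivative_bounded_linear)
  have 1: "((\<lambda>t. u + t *\<^sub>R (x - u)) has_derivative (\<lambda>t. t *\<^sub>R (x - u))) (at 0 within {0..1})"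
    by (auto intro!: derivative_eq_intros)
  have "((\<lambda>t. g (u + t *\<^sub>R (x - u))) has_derivative (\<lambda>t. g' (t *\<^sub>R (x - u)))) (at 0 within {0..1})"
    using has_derivative_in_compose[OF 1, of g g'] has_derivative_subset[OF g sub] by simp
  then have "((\<lambda>t. g (u + t *\<^sub>R (x - u))) has_field_derivative g' (x - u)) (at 0 within {0..1})"
    by (simp add: has_field_derivative_def g'.scaleR mult.commute[of _ "g' (x - u)"])
  then have "((\<lambda>t. (g (u + t *\<^sub>R (x - u)) - g u) / t) \<longlongrightarrow> g' (x - u)) (at 0 within {0..1})"
    by (simp add: has_field_derivative_iff)
  moreover have "\<forall>\<^sub>F t in at 0 within {0..1}. c \<le> (g (u + t *\<^sub>R (x - u)) - g u) / t"
    unfolding eventually_at_filter using le by (auto simp: field_simps intro!: always_eventually)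
  moreover have "at (0::real) within {0..1} \<noteq> bot"
    by (simp add: trivial_limit_within islimpt_Icc)
  ultimately show ?thesis by (rule tendsto_lowerbound)
qed

text \<open>This is the gradient inequality for \<open>d\<close>: convexity bounds the difference
  quotients from above by \<open>d x - d u\<close>, so the previous lemma is applied to
  \<open>- d\<close>.\<close>

lemma bregman_nonneg:
  assumes "convex Q" "convex_on Q d" "u \<in> Q" "x \<in> Q"
    and d: "(d has_derivative blinfun_apply (grad_d u)) (at u within Q)"
  shows "0 \<le> bregman d grad_d u x"
proof -
  have "- (d x - d u) \<le> - blinfun_apply (grad_d u) (x - u)"
  proof (rule directional_derivative_ge[OF assms(1,3,4) has_derivative_minus[OF d]])
    fix t :: real assume "0 < t" "t \<le> 1"
    then have "d (u + t *\<^sub>R (x - u)) \<le> (1 - t) * d u + t * d x"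
      using convex_onD[OF assms(2), of t u x] assms by (simp add: algebra_simps)
    then show "t * - (d x - d u) \<le> - d (u + t *\<^sub>R (x - u)) - - d u"
      by (simp add: algebra_simps)
  qed
  then show ?thesis by (simp add: bregman_def)
qed

lemma bregman_three_point:
  "bregman d grad_d z x - bregman d grad_d z u - bregman d grad_d u x
    = blinfun_apply (grad_d u) (x - u) - blinfun_apply (grad_d z) (x - u)"
  by (simp add: bregman_def blinfun.bilinear_simps)

text \<open>The subgradient \<open>h\<close> belongs to the whole sum and is never split. Its
  inequality is tested along the segment towards \<open>x\<close>: convexity bounds the increment of
  \<open>\<phi>\<close> by \<open>t * (\<phi> x - \<phi> u)\<close>, and the rest bounds the
  directional derivative of the smooth part, which the three-point identity then rewrites.\<close>

lemma inexact_argmin_bregman: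
  assumes Q: "convex Q" and x: "x \<in> Q" and \<phi>: "convex_on Q \<phi>" and "0 \<le> L"
    and u: "u \<in> inexact_argmin Q \<epsilon> (\<lambda>w. \<phi> w + L * bregman d grad_d z w)"
    and d: "(d has_derivative blinfun_apply (grad_d u)) (at u within Q)"
  shows "\<phi> u + L * bregman d grad_d z u + L * bregman d grad_d u x - \<epsilon>
    \<le> \<phi> x + L * bregman d grad_d z x"
proof -
  let ?B = "bregman d grad_d z"
  from u obtain h where uQ: "u \<in> Q"
    and sub: "\<And>w. w \<in> Q \<Longrightarrow> \<phi> u + L * ?B u + blinfun_apply h (w - u) \<le> \<phi> w + L * ?B w"
    and h: "- \<epsilon> \<le> blinfun_apply h (x - u)"
    using x by (auto simp: inexact_argmin_def subdifferential_on_def)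
  have "((\<lambda>w. L * ?B w) has_derivative
      (\<lambda>w. L * (blinfun_apply (grad_d u) w - blinfun_apply (grad_d z) w))) (at u within Q)"
    unfolding bregman_def by (auto intro!: derivative_eq_intros d simp: blinfun.bilinear_simps)
  then have "- \<epsilon> - (\<phi> x - \<phi> u)
      \<le> L * (blinfun_apply (grad_d u) (x - u) - blinfun_apply (grad_d z) (x - u))"
  proof (rule directional_derivative_ge[OF Q uQ x])
    fix t :: real assume t: "0 < t" "t \<le> 1"
    let ?w = "u + t *\<^sub>R (x - u)"
    have w: "?w = (1 - t) *\<^sub>R u + t *\<^sub>R x" by (simp add: algebra_simps)
    have "?w \<in> Q" using convexD_alt[OF Q uQ x, of t] t by (simp add: w)
    then have "\<phi> u + L * ?B u + t * blinfun_apply h (x - u) \<le> \<phi> ?w + L * ?B ?w"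
      using sub[of ?w] by (simp add: blinfun.bilinear_simps)
    moreover have "\<phi> ?w \<le> (1 - t) * \<phi> u + t * \<phi> x"
      using convex_onD[OF \<phi>, of t u x] t uQ x by (simp add: w)
    moreover have "t * - \<epsilon> \<le> t * blinfun_apply h (x - u)"
      using h t by (intro mult_left_mono) auto
    ultimately show "t * (- \<epsilon> - (\<phi> x - \<phi> u)) \<le> L * ?B ?w - L * ?B u"
      by (simp add: algebra_simps)
  qed
  then show ?thesis
    unfolding bregman_three_point[of d, symmetric] by (simp add: algebra_simps)
qed

text \<open>The upper model bound at \<open>u\<close>, with the model value at \<open>z\<close>
  replaced by the larger \<open>f z\<close>, is added to strong convexity at \<open>w\<close>. The
  terms in \<open>V[z](u)\<close> and \<open>\<psi>\<close> cancel against the first-order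
  condition.\<close>

lemma inexact_gradient_step:
  assumes "convex Q" and "w \<in> Q" and "z \<in> Q" and "0 \<le> L"
    and model: "is_model Q (bregman d grad_d) \<delta> L f \<psi> z"
    and sc: "right_relatively_strongly_convex Q (bregman d grad_d) \<mu> f \<psi>"
    and u: "u \<in> inexact_argmin Q \<epsilon> (\<lambda>w. \<psi> w z + L * bregman d grad_d z w)"
    and d: "(d has_derivative blinfun_apply (grad_d u)) (at u within Q)"
  shows "f u - f w \<le> (L - \<mu>) * bregman d grad_d z w - L * bregman d grad_d u w + \<delta> + \<epsilon>"
proof -
  have "u \<in> Q" using u by (simp add: inexact_argmin_def)
  then have "f u \<le> f z + \<psi> u z + L * bregman d grad_d z u + \<delta>"
    using model by (fastforce simp: is_model_def)
  moreover have "\<mu> * bregman d grad_d z w \<le> f w - f z - \<psi> w z"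
    using sc assms(2,3) by (simp add: right_relatively_strongly_convex_def)
  moreover have "convex_on Q (\<lambda>w. \<psi> w z)" using model by (simp add: is_model_def)
  note inexact_argmin_bregman[OF assms(1,2) this assms(4) u d]
  ultimately show ?thesis by (simp add: algebra_simps)
qed

text \<open>The recursion is assumed only below \<open>n\<close> and \<open>c\<close> may have any
  sign: the constant used later contains the smallest gap among the first \<open>n\<close>
  iterates.\<close>

lemma affine_recursion_le:
  fixes v :: "nat \<Rightarrow> real"
  assumes "0 \<le> q" and "\<And>i. i < n \<Longrightarrow> v (Suc i) \<le> q * v i + c"
  shows "v n \<le> q ^ n * v 0 + c * (\<Sum>j<n. q ^ j)"
  using assms(2)
proof (induction n)
  case (Suc n)
  have "v (Suc n) \<le> q * v n + c" using Suc.prems by simp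
  also have "\<dots> \<le> q * (q ^ n * v 0 + c * (\<Sum>j<n. q ^ j)) + c"
    using Suc assms(1) by (intro add_right_mono mult_left_mono) auto
  also have "\<dots> = q ^ Suc n * v 0 + c * (\<Sum>j<Suc n. q ^ j)"
    by (simp add: sum.lessThan_Suc_shift sum_distrib_left algebra_simps del: sum.lessThan_Suc)
  finally show ?case .
qed simp

theorem theorem24:
  fixes Q :: "'a::euclidean_space set"
    and f d :: "'a \<Rightarrow> real"
    and grad_d :: "'a \<Rightarrow> ('a \<Rightarrow>\<^sub>L real)"
    and \<psi> :: "'a \<Rightarrow> 'a \<Rightarrow> real"
    and \<delta> \<delta>' \<mu> L :: real
    and x_star :: 'a
    and x y :: "nat \<Rightarrow> 'a"
  assumes "convex Q"
    and "convex_on Q d"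
    and "\<And>z. z \<in> Q \<Longrightarrow> (d has_derivative blinfun_apply (grad_d z)) (at z within Q)"
    and "convex_on Q f"
    and "is_arg_min f (\<lambda>z. z \<in> Q) x_star"
    and "\<delta> \<ge> 0" and "\<delta>' \<ge> 0"
    and "0 < \<mu>" and "\<mu> \<le> L"
    and "\<And>z. z \<in> Q \<Longrightarrow> is_model Q (bregman d grad_d) \<delta> L f \<psi> z"
    and "right_relatively_strongly_convex Q (bregman d grad_d) \<mu> f \<psi>"
    and "x 0 \<in> Q"
    and "\<And>k. x (k + 1) \<in> inexact_argmin Q \<delta>' (\<lambda>z. \<psi> z (x k) + L * bregman d grad_d (x k) z)"
    and "\<And>k. is_arg_min f (\<lambda>z. z \<in> x ` {1..k + 1}) (y (k + 1))"
  shows "\<forall>k. f (y (k + 1)) - f x_star \<le> L * bregman d grad_d (x 0) x_star * exp (- real (k + 1) * (\<mu> / L)) + \<delta> + \<delta>'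
           \<and> bregman d grad_d (x (k + 1)) x_star \<le> 1 / \<mu> * (\<delta> + \<delta>') + (1 - \<mu> / L) ^ (k + 1) * bregman d grad_d (x 0) x_star"
proof (rule allI)
  fix k
  define v where "v i = bregman d grad_d (x i) x_star" for i
  define q where "q = 1 - \<mu> / L"
  have L: "0 < L" using assms(8,9) by simp
  have q: "0 \<le> q" "q < 1" using assms(8,9) L by (auto simp: q_def)
  have star: "x_star \<in> Q" and min: "\<And>z. z \<in> Q \<Longrightarrow> f x_star \<le> f z"
    using assms(5) by (auto simp: is_arg_min_linorder)
  have xQ: "x i \<in> Q" for i
    using assms(12) assms(13)[of "i - 1"] by (cases i) (auto simp: inexact_argmin_def)
  have v0: "0 \<le> v i" for i
    unfolding v_def using assms(1,2) xQ star assms(3)[OF xQ] by (rule bregman_nonneg)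
  \<comment> \<open>The lower bound \<open>g\<close> of the gap is left free: \<open>g = 0\<close>
    serves the bound on \<open>V\<close>, the smallest gap serves the bound on
    \<open>f\<close>.\<close>
  have step: "v (Suc i) \<le> q * v i + (\<delta> + \<delta>' - g) / L" if "g \<le> f (x (Suc i)) - f x_star" for g i
  proof -
    have "f (x (Suc i)) - f x_star \<le> (L - \<mu>) * v i - L * v (Suc i) + \<delta> + \<delta>'"
      unfolding v_def
      using inexact_gradient_step[OF assms(1) star xQ _ assms(10)[OF xQ] assms(11) assms(13)
          assms(3)[OF xQ], of i] L by simp
    then have "L * v (Suc i) \<le> (L - \<mu>) * v i + (\<delta> + \<delta>' - g)"
      using that by simp
    then have "v (Suc i) \<le> ((L - \<mu>) * v i + (\<delta> + \<delta>' - g)) / L"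
      using L by (simp add: pos_le_divide_eq mult.commute)
    also have "\<dots> = q * v i + (\<delta> + \<delta>' - g) / L"
      using L by (simp add: q_def add_divide_distrib diff_divide_distrib left_diff_distrib)
    finally show ?thesis .
  qed
  let ?S = "\<Sum>j<k + 1. q ^ j"
  \<comment> \<open>Geometric sum with \<open>1 - q = \<mu> / L\<close>.\<close>
  have S: "?S = (1 - q ^ (k + 1)) * (L / \<mu>)"
    using q assms(8) L sum_gp_strict[of q "k + 1"] by (simp add: q_def)
  have bound_v: "v (k + 1) \<le> 1 / \<mu> * (\<delta> + \<delta>') + (1 - \<mu> / L) ^ (k + 1) * v 0"
  proof -
    have "v (k + 1) \<le> q ^ (k + 1) * v 0 + (\<delta> + \<delta>') / L * ?S"
      using step[of 0] min[OF xQ] by (intro affine_recursion_le q) simp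
    also have "(\<delta> + \<delta>') / L * ?S = (\<delta> + \<delta>') / \<mu> * (1 - q ^ (k + 1))"
      using L assms(8) unfolding S by simp
    also have "\<dots> \<le> (\<delta> + \<delta>') / \<mu> * 1"
      using assms(6-8) q by (intro mult_left_mono) auto
    finally show ?thesis by (simp add: q_def)
  qed
  have bound_f: "f (y (k + 1)) - f x_star
    \<le> L * v 0 * exp (- real (k + 1) * (\<mu> / L)) + \<delta> + \<delta>'"
  proof -
    define g where "g = f (y (k + 1)) - f x_star"
    let ?e = "L * v 0 * exp (- real (k + 1) * (\<mu> / L))"
    have "g - (\<delta> + \<delta>') \<le> ?e"
    \<comment> \<open>Only a positive excess \<open>g - (\<delta> + \<delta>')\<close> allows the
      factor \<open>?S\<close> to be lowered to \<open>1\<close> below.\<close>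
    proof (cases "g \<le> \<delta> + \<delta>'")
      case True
      moreover have "0 \<le> ?e" using v0[of 0] L by simp
      ultimately show ?thesis by linarith
    next
      case False
      have g: "g \<le> f (x (Suc i)) - f x_star" if "i < k + 1" for i
        using assms(14)[of k] that by (auto simp: g_def is_arg_min_linorder)
      \<comment> \<open>The left side of the recursion bound is \<open>v (k + 1)\<close>, discarded
        as nonnegative.\<close>
      have "0 \<le> q ^ (k + 1) * v 0 + (\<delta> + \<delta>' - g) / L * ?S"
        using v0[of "k + 1"] affine_recursion_le[where v = v, OF q(1) step[OF g], of "k + 1"] by linarith
      moreover have "(\<delta> + \<delta>' - g) / L = - ((g - (\<delta> + \<delta>')) / L)"
        by (simp add: minus_divide_left)
      ultimately have "(g - (\<delta> + \<delta>')) / L * ?S \<le> q ^ (k + 1) * v 0"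
        by (simp only: mult_minus_left)
      \<comment> \<open>Only the term \<open>j = 0\<close> of the sum is kept.\<close>
      moreover have "1 \<le> ?S"
        using q sum_nonneg[of "{..<k}" "\<lambda>j. q ^ Suc j"]
        by (simp add: sum.lessThan_Suc_shift del: sum.lessThan_Suc)
      then have "(g - (\<delta> + \<delta>')) / L * 1 \<le> (g - (\<delta> + \<delta>')) / L * ?S"
        using False L by (intro mult_left_mono) auto
      ultimately have "(g - (\<delta> + \<delta>')) / L \<le> q ^ (k + 1) * v 0" by simp
      \<comment> \<open>Here \<open>1 - t \<le> exp (- t)\<close> is used at
        \<open>t = \<mu> / L\<close>; raising to a power needs \<open>0 \<le> q\<close>.\<close>
      also have "\<dots> \<le> exp (- (\<mu> / L)) ^ (k + 1) * v 0"
        using q v0 exp_ge_add_one_self[of "- (\<mu> / L)"]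
        by (intro mult_right_mono power_mono) (auto simp: q_def)
      also have "exp (- (\<mu> / L)) ^ (k + 1) = exp (- real (k + 1) * (\<mu> / L))"
        by (simp only: exp_of_nat_mult[symmetric] mult_minus_left mult_minus_right)
      finally show ?thesis using L by (simp add: field_simps)
    qed
    then show ?thesis by (simp add: g_def)
  qed
  show "f (y (k + 1)) - f x_star \<le> L * bregman d grad_d (x 0) x_star * exp (- real (k + 1) * (\<mu> / L)) + \<delta> + \<delta>'
      \<and> bregman d grad_d (x (k + 1)) x_star \<le> 1 / \<mu> * (\<delta> + \<delta>') + (1 - \<mu> / L) ^ (k + 1) * bregman d grad_d (x 0) x_star"
    using bound_f bound_v unfolding v_def by (rule conjI)
qed

end
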